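(* Let $p,q,r>0$ be integers and let $L$ be the alternating oriented link obtained as the closure of the 4-braid $\sigma_1^p\sigma_2^{-q}\sigma_3^r$. Then, with $s=-t$ and up to multiplication by a unit of $\mathbb{Z}[s^{1/2},s^{-1/2}]$, the Alexander polynomial of $L$ is $$\Delta_L(s)=[p][q][r].$$ Moreover, $\Delta_L(s)$ is trapezoidal, and the length $l$ of its stable part satisfies $l\le|\sigma(L)|$, where $\sigma(L)$ is the signature of $L$.
   Context: $\sigma_1,\sigma_2,\sigma_3$ are the standard generators of the braid group $B_4$; the closure of a braid is oriented with all strands parallel. The Alexander polynomial $\Delta_L(t)\in\mathbb{Z}[t^{\pm1/2}]$ of an oriented link is determined by $\Delta_{\text{unknot}}=1$ and $\Delta_{L_+}(t)-\Delta_{L_-}(t)=(\sqrt t-1/\sqrt t)\,\Delta_{L_0}(t)$. The substitution $s=-t$ is made, and polynomials are taken up to units (up to sign and powers of the variable$^{1/2}$); i.e. the formula means $\Delta_L(t)=\pm t^{k/2}F(-t)$ for some integer $k$, where $F(s)=[p][q][r]$. For a positive integer $n$, $[n]=\frac{1-s^n}{1-s}=1+s+\dots+s^{n-1}$. A polynomial $\sum_{k=0}^{n}a_ks^{k+r}$ ($r\in\mathbb{Z}$) is symmetric if $a_k=a_{n-k}$ for all $0\le k\le n$. It is trapezoidal if for some $0\le i\le j\le n$ one has $a_0<a_1<\dots<a_i=a_{i+1}=\dots=a_j>a_{j+1}>\dots>a_n$. For a symmetric trapezoidal polynomial with all $a_k\ne0$ ($0\le k\le n$), the length of its stable part is the largest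 integer $l$ such that $a_{k_0}=a_{k_0+1}=\dots=a_{k_0+l}$ for some $k_0$. The signature of an oriented link is the signature of $M+M^T$ for a Seifert matrix $M$. *)

theory Defs
  imports "HOL-Library.Poly_Mapping" "Jordan_Normal_Form.Char_Poly"
begin

section \<open>Laurent polynomials\<close>

text \<open>
  Finitely supported maps \<open>int \<Rightarrow>\<^sub>0 int\<close> with the convolution product form the ring of integral
  Laurent polynomials in one variable; \<open>Poly_Mapping.single k c\<close> is the monomial with exponent
  \<open>k\<close> and coefficient \<open>c\<close>.  The type is used both for polynomials in \<open>s\<close> and
  for polynomials in the square root \<open>x\<close> of \<open>t\<close>, i.e. for the ring of integral Laurent
  polynomials in \<open>t\<close> to the power 1/2.
\<close>

type_synonym laurent = "int \<Rightarrow>\<^sub>0 int"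

definition q_bracket :: "nat \<Rightarrow> laurent" where
  "q_bracket n = (\<Sum>k<n. Poly_Mapping.single (int k) 1)"

text \<open>The substitution \<open>s = - t\<close>, where \<open>t\<close> is the square of the variable of the result.\<close>

definition at_minus_t :: "laurent \<Rightarrow> laurent" where
  "at_minus_t F = (\<Sum>j\<in>Poly_Mapping.keys F.
     Poly_Mapping.single (2 * j) ((- 1) ^ nat \<bar>j\<bar> * Poly_Mapping.lookup F j))"

text \<open>
  In the following predicates \<open>f\<close> is presented as the sum of the \<open>a k\<close> times the
  \<open>k + r\<close>-th power of the variable, \<open>k = 0, \<dots>, n\<close>.
\<close>

definition presented :: "laurent \<Rightarrow> int \<Rightarrow> nat \<Rightarrow> (nat \<Rightarrow> int) \<Rightarrow> bool" where
  "presented f r n a \<longleftrightarrow> f = (\<Sum>k\<le>n. Poly_Mapping.single (int k + r) (a k))"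

definition symmetric_coeffs :: "nat \<Rightarrow> (nat \<Rightarrow> int) \<Rightarrow> bool" where
  "symmetric_coeffs n a \<longleftrightarrow> (\<forall>k\<le>n. a k = a (n - k))"

definition trapezoidal_coeffs :: "nat \<Rightarrow> (nat \<Rightarrow> int) \<Rightarrow> bool" where
  "trapezoidal_coeffs n a \<longleftrightarrow> (\<exists>i j. i \<le> j \<and> j \<le> n \<and>
     (\<forall>k<i. a k < a (k + 1)) \<and>
     (\<forall>k. i \<le> k \<and> k < j \<longrightarrow> a k = a (k + 1)) \<and>
     (\<forall>k. j \<le> k \<and> k < n \<longrightarrow> a k > a (k + 1)))"

definition trapezoidal :: "laurent \<Rightarrow> bool" where
  "trapezoidal f \<longleftrightarrow> (\<exists>r n a. presented f r n a \<and> trapezoidal_coeffs n a)"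

definition constant_run :: "nat \<Rightarrow> (nat \<Rightarrow> int) \<Rightarrow> nat \<Rightarrow> bool" where
  "constant_run n a l \<longleftrightarrow> (\<exists>k. k + l \<le> n \<and> (\<forall>j\<le>l. a (k + j) = a k))"

text \<open>
  The length of the stable part is a relation because it is only defined for symmetric trapezoidal
  polynomials without vanishing coefficients.
\<close>

definition stable_part_length :: "laurent \<Rightarrow> nat \<Rightarrow> bool" where
  "stable_part_length f l \<longleftrightarrow> (\<exists>r n a. presented f r n a \<and> (\<forall>k\<le>n. a k \<noteq> 0) \<and>
     symmetric_coeffs n a \<and> trapezoidal_coeffs n a \<and>
     constant_run n a l \<and> (\<forall>m. constant_run n a m \<longrightarrow> m \<le> l))"


section \<open>Oriented links as closed braids\<close>

text \<open>
  A pair \<open>(n, w)\<close> stands for the closure, all strands oriented in parallel, of the braid on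
  \<open>n\<close> strands with word \<open>w\<close>; the letter \<open>i > 0\<close> is the standard generator \<open>\<sigma>\<^sub>i\<close>
  (a positive crossing), \<open>- i\<close> its inverse.  Every oriented link arises in this way (Alexander), and
  two closed braids are isotopic iff they are related by the moves below (Markov): the relations of
  the braid group, conjugation, and (de)stabilization.
\<close>

type_synonym closed_braid = "nat \<times> int list"

definition braid_words :: "nat \<Rightarrow> int list set" where
  "braid_words n = {w. \<forall>g\<in>set w. g \<noteq> 0 \<and> \<bar>g\<bar> < int n}"

inductive markov_move :: "closed_braid \<Rightarrow> closed_braid \<Rightarrow> bool" where
  cancel: "u @ [g, - g] @ v \<in> braid_words n \<Longrightarrow>
    markov_move (n, u @ [g, - g] @ v) (n, u @ v)"
| commute: "u @ [g, h] @ v \<in> braid_words n \<Longrightarrow> \<bar>\<bar>g\<bar> - \<bar>h\<bar>\<bar> \<ge> 2 \<Longrightarrow>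
    markov_move (n, u @ [g, h] @ v) (n, u @ [h, g] @ v)"
| braid: "u @ [i, i + 1, i] @ v \<in> braid_words n \<Longrightarrow> i > 0 \<Longrightarrow>
    markov_move (n, u @ [i, i + 1, i] @ v) (n, u @ [i + 1, i, i + 1] @ v)"
| conjugate: "u @ v \<in> braid_words n \<Longrightarrow>
    markov_move (n, u @ v) (n, v @ u)"
| stabilize: "w \<in> braid_words n \<Longrightarrow> n \<ge> 1 \<Longrightarrow> e \<in> {1, - 1} \<Longrightarrow>
    markov_move (n, w) (Suc n, w @ [e * int n])"

definition isotopic :: "closed_braid \<Rightarrow> closed_braid \<Rightarrow> bool" where
  "isotopic = equivclp markov_move"


section \<open>The Alexander polynomial\<close>

text \<open>
  \<open>alexander_polynomial \<Delta>\<close> says that \<open>\<Delta>\<close> assigns to every oriented link its Alexander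
  polynomial, as determined by isotopy invariance, the value on the unknot and the skein relation.
  Values are Laurent polynomials in \<open>x\<close>, the square root of \<open>t\<close>.
\<close>

definition alexander_polynomial :: "(closed_braid \<Rightarrow> laurent) \<Rightarrow> bool" where
  "alexander_polynomial \<Delta> \<longleftrightarrow>
     (\<forall>K L. isotopic K L \<longrightarrow> \<Delta> K = \<Delta> L) \<and>
     \<Delta> (1, []) = 1 \<and>
     (\<forall>n u i v. u @ [i] @ v \<in> braid_words n \<and> i > 0 \<longrightarrow>
        \<Delta> (n, u @ [i] @ v) - \<Delta> (n, u @ [- i] @ v) =
        (Poly_Mapping.single 1 1 - Poly_Mapping.single (- 1) 1) * \<Delta> (n, u @ v))"


section \<open>Seifert matrix and signature\<close>

text \<open>
  Seifert's algorithm turns a closed braid into a surface made of one disk per strand, stacked on top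
  of each other, and one half-twisted band per letter: the band of a letter \<open>\<plusminus> i\<close> joins the
  disks \<open>i\<close> and \<open>i + 1\<close>.  Its first homology has a basis consisting of the loops that run up
  one band and down the next band between the same two disks; such a loop is given by the positions
  \<open>(k, l)\<close> of these two bands in the word.
\<close>

definition seifert_loops :: "int list \<Rightarrow> (nat \<times> nat) list" where
  "seifert_loops w = filter (\<lambda>(k, l). k < l \<and> \<bar>w ! k\<bar> = \<bar>w ! l\<bar> \<and>
       (\<forall>m. k < m \<and> m < l \<longrightarrow> \<bar>w ! m\<bar> \<noteq> \<bar>w ! k\<bar>))
     (List.product [0..<length w] [0..<length w])"

text \<open>
  Linking number of the loop \<open>(k, l)\<close> with the push-off of the loop \<open>(k', l')\<close>: a loop
  and its own push-off are twisted around each other by the two half twists of its bands; loops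
  following each other between the same two disks run in opposite directions through their common
  band; loops on neighbouring sides of a common disk are linked only if their end points on the
  boundary of that disk interleave, and then for only one of the two choices of the loop that is
  pushed off.
\<close>

definition seifert_linking :: "int list \<Rightarrow> nat \<times> nat \<Rightarrow> nat \<times> nat \<Rightarrow> int" where
  "seifert_linking w = (\<lambda>(k, l) (k', l').
     if (k, l) = (k', l') then - ((sgn (w ! k) + sgn (w ! l)) div 2)
     else if \<bar>w ! k\<bar> = \<bar>w ! k'\<bar> then
       (if l = k' then (if w ! l > 0 then 1 else 0)
        else if l' = k then (if w ! k > 0 then 0 else - 1)
        else 0)
     else if \<bar>w ! k\<bar> = \<bar>w ! k'\<bar> + 1 then
       (if k < k' \<and> k' < l \<and> l < l' then 1
        else if k' < k \<and> k < l' \<and> l' < l then - 1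
        else 0)
     else 0)"

definition seifert_matrix :: "int list \<Rightarrow> int mat" where
  "seifert_matrix w = (let ls = seifert_loops w in
     mat (length ls) (length ls) (\<lambda>(a, b). seifert_linking w (ls ! a) (ls ! b)))"

text \<open>Eigenvalues are counted with multiplicity.\<close>

definition matrix_signature :: "real mat \<Rightarrow> int" where
  "matrix_signature A =
     int (\<Sum>x | x > 0 \<and> eigenvalue A x. order x (char_poly A)) -
     int (\<Sum>x | x < 0 \<and> eigenvalue A x. order x (char_poly A))"

definition link_signature :: "closed_braid \<Rightarrow> int" where
  "link_signature = (\<lambda>(n, w). let M = seifert_matrix w in
     matrix_signature (map_mat real_of_int (M + transpose_mat M)))"

end

theory Submission
  imports Defs
begin

text \<open>
  Removing the last block of the braid word: by the skein relation, \<open>\<Delta>\<close> as a function of the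
  exponent of the last generator satisfies \<open>A (m + 2) = A m \<plusminus> (x - 1/x) A (m + 1)\<close>; it
  vanishes for \<open>m = 0\<close> (split link), and \<open>m = 1\<close> is a Markov stabilization. Up to a unit,
  the solution is the bracket of \<open>m\<close> at \<open>s = - t\<close>, so three steps give the product formula.

  If \<open>z\<close> is the largest of the three exponents and \<open>b\<close> are the coefficients of the product of
  the other two brackets, consecutive coefficients of the full product differ by
  \<open>b k - b (k - z)\<close>. This is positive until either \<open>b\<close> ends or the centre of symmetry is
  reached.

  The symmetrized Seifert matrix is a direct sum of Cartan matrices of type A with signs
  \<open>-, +, -\<close>, so the signature is \<open>(q - 1) - (p - 1) - (r - 1)\<close>; it has the same
  parity as the degree of the product.
\<close>

section \<open>The Alexander polynomial\<close>

lemma at_minus_t_superset: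
  assumes "finite S" "Poly_Mapping.keys F \<subseteq> S"
  shows "at_minus_t F = (\<Sum>j\<in>S. Poly_Mapping.single (2 * j) ((- 1) ^ nat \<bar>j\<bar> * Poly_Mapping.lookup F j))"
  unfolding at_minus_t_def
  by (rule sum.mono_neutral_left) (use assms in \<open>auto simp: in_keys_iff\<close>)

lemma at_minus_t_add: "at_minus_t (F + G) = at_minus_t F + at_minus_t G"
proof -
  let ?S = "Poly_Mapping.keys F \<union> Poly_Mapping.keys G"
  have "Poly_Mapping.keys (F + G) \<subseteq> ?S" by (rule Poly_Mapping.keys_add)
  then show ?thesis
    by (simp add: at_minus_t_superset[of ?S] lookup_add distrib_left single_add sum.distrib)
qed

lemma at_minus_t_zero [simp]: "at_minus_t 0 = 0"
  by (simp add: at_minus_t_def)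

lemma at_minus_t_sum: "at_minus_t (\<Sum>i\<in>I. f i) = (\<Sum>i\<in>I. at_minus_t (f i))"
  by (induction I rule: infinite_finite_induct) (simp_all add: at_minus_t_add)

lemma at_minus_t_single:
  "at_minus_t (Poly_Mapping.single j c) = Poly_Mapping.single (2 * j) ((- 1) ^ nat \<bar>j\<bar> * c)"
  by (simp add: at_minus_t_superset[of "{j}"])

text \<open>Parity is additive and unaffected by the absolute value; this makes the substitution
  multiplicative on monomials.\<close>

lemma minus_one_power_nat_abs_add:
  "(- 1 :: int) ^ nat \<bar>i + j\<bar> = (- 1) ^ nat \<bar>i\<bar> * (- 1) ^ nat \<bar>j\<bar>"
  by (simp add: minus_one_power_iff even_nat_iff)

lemma poly_mapping_sum_singles:
  "(\<Sum>j\<in>Poly_Mapping.keys F. Poly_Mapping.single j (Poly_Mapping.lookup F j)) = F"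
  by (rule poly_mapping_eqI)
     (auto simp: lookup_sum lookup_single when_def in_keys_iff)

lemma at_minus_t_mult: "at_minus_t (F * G) = at_minus_t F * at_minus_t G"
proof -
  let ?s = "\<lambda>F j. Poly_Mapping.single j (Poly_Mapping.lookup F j)"
  have "at_minus_t (F * G) =
      at_minus_t ((\<Sum>i\<in>Poly_Mapping.keys F. ?s F i) * (\<Sum>j\<in>Poly_Mapping.keys G. ?s G j))"
    by (simp only: poly_mapping_sum_singles)
  also have "\<dots> = (\<Sum>i\<in>Poly_Mapping.keys F. \<Sum>j\<in>Poly_Mapping.keys G.
      at_minus_t (?s F i) * at_minus_t (?s G j))"
    by (simp add: sum_product at_minus_t_sum mult_single at_minus_t_single
        minus_one_power_nat_abs_add algebra_simps)
  also have "\<dots> = at_minus_t (\<Sum>i\<in>Poly_Mapping.keys F. ?s F i) *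
      at_minus_t (\<Sum>j\<in>Poly_Mapping.keys G. ?s G j)"
    by (simp add: sum_product at_minus_t_sum)
  also have "\<dots> = at_minus_t F * at_minus_t G"
    by (simp only: poly_mapping_sum_singles)
  finally show ?thesis .
qed

section \<open>Closed form of the skein recursion\<close>

lemma single_power: "Poly_Mapping.single (a :: int) (c :: int) ^ k = Poly_Mapping.single (int k * a) (c ^ k)"
  by (induction k) (simp_all add: mult_single algebra_simps)

lemma at_minus_t_q_bracket:
  "at_minus_t (q_bracket n) = (\<Sum>k<n. Poly_Mapping.single 2 (- 1) ^ k)"
  by (simp add: q_bracket_def at_minus_t_sum at_minus_t_single single_power mult.commute)

text \<open>The recursion is the skein relation in the exponent of one generator, normalized by a
  split link at 0 and a stabilization at 1.\<close>

fun skein_seq :: "laurent \<Rightarrow> nat \<Rightarrow> laurent" where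
  "skein_seq z 0 = 0"
| "skein_seq z (Suc 0) = 1"
| "skein_seq z (Suc (Suc n)) = skein_seq z n + z * skein_seq z (Suc n)"

text \<open>The characteristic roots of the recursion are \<open>X\<close> and \<open>- Y\<close>,
  so splitting off the root \<open>X\<close> leaves a geometric sequence with ratio
  \<open>- Y\<close>.\<close>

lemma skein_seq_Suc:
  assumes "X * Y = 1"
  shows "skein_seq (X - Y) (Suc n) = X * skein_seq (X - Y) n + (- Y) ^ n"
proof (induction n)
  case (Suc n)
  have "Y * skein_seq (X - Y) (Suc n) = skein_seq (X - Y) n - (- Y) ^ Suc n"
  proof -
    have "Y * (X * skein_seq (X - Y) n) = skein_seq (X - Y) n"
      using assms by (metis mult.assoc mult.commute mult_1)
    with Suc.IH show ?thesis by (simp add: distrib_left)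
  qed
  then show ?case by (simp add: algebra_simps)
qed simp

text \<open>The ratio of the characteristic roots \<open>X\<close> and \<open>- Y\<close> is
  \<open>- (X ^ 2)\<close>, because \<open>Y\<close> is the inverse of \<open>X\<close>. The usual
  quotient formula thus becomes a geometric sum, free of division.\<close>

lemma skein_seq_geometric:
  assumes "X * Y = 1"
  shows "skein_seq (X - Y) (Suc n) = (- Y) ^ n * (\<Sum>k<Suc n. (- (X ^ 2)) ^ k)"
proof (induction n)
  case (Suc n)
  let ?S = "\<Sum>k<Suc n. (- (X ^ 2)) ^ k"
  have *: "(\<Sum>k<Suc (Suc n). (- (X ^ 2)) ^ k) = 1 - X ^ 2 * ?S"
    by (subst sum.lessThan_Suc_shift) (simp add: sum_distrib_left sum_negf del: sum.lessThan_Suc)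
  have "Y * X ^ 2 = X"
    using assms by (metis mult.assoc mult.commute mult_1 power2_eq_square)
  then have "(- Y) ^ Suc n * (1 - X ^ 2 * ?S) = X * ((- Y) ^ n * ?S) + (- Y) ^ Suc n"
    by (simp add: algebra_simps del: sum.lessThan_Suc)
  then show ?case
    unfolding * skein_seq_Suc[OF assms, of "Suc n"] Suc.IH by simp
qed simp

text \<open>Here \<open>X\<close> is e x and \<open>Y\<close> is e / x with x the square root of t,
  so \<open>- (X ^ 2)\<close> is -t = s and the power of \<open>- Y\<close> is the unit in
  front.\<close>

lemma skein_seq_eq_q_bracket:
  assumes "e \<in> {1, - 1}"
  shows "skein_seq (Poly_Mapping.single 1 e - Poly_Mapping.single (- 1) e) (Suc n) =
    Poly_Mapping.single (- int n) ((- e) ^ n) * at_minus_t (q_bracket (Suc n))"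
proof -
  have e: "e * e = 1" using assms by auto
  have "Poly_Mapping.single (1 :: int) e * Poly_Mapping.single (- 1) e = 1"
    by (simp add: mult_single e)
  moreover have "- (Poly_Mapping.single (1 :: int) e ^ 2) = Poly_Mapping.single 2 (- 1)"
    by (simp add: power2_eq_square mult_single e single_uminus)
  moreover have "(- Poly_Mapping.single (- 1 :: int) e) ^ n = Poly_Mapping.single (- int n) ((- e) ^ n)"
    by (simp add: single_uminus[symmetric] single_power)
  ultimately show ?thesis
    by (simp add: skein_seq_geometric at_minus_t_q_bracket del: sum.lessThan_Suc)
qed

section \<open>The skein relation on blocks of a braid word\<close>

lemma alexander_markov_move:
  assumes "alexander_polynomial \<Delta>" "markov_move K L"
  shows "\<Delta> K = \<Delta> L"
  using assms(1) r_into_equivclp[of markov_move, OF assms(2)]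
  unfolding alexander_polynomial_def isotopic_def by blast

text \<open>For \<open>e = - 1\<close> the two crossings swap roles, which negates the skein factor;
  the coefficients \<open>e\<close> absorb this sign.\<close>

lemma alexander_skein:
  assumes "alexander_polynomial \<Delta>" "u @ [e * i] @ v \<in> braid_words n" "i > 0" "e \<in> {1, - 1}"
  shows "\<Delta> (n, u @ [e * i] @ v) - \<Delta> (n, u @ [- (e * i)] @ v) =
    (Poly_Mapping.single 1 e - Poly_Mapping.single (- 1) e) * \<Delta> (n, u @ v)"
proof -
  have "u @ [i] @ v \<in> braid_words n" using assms by (auto simp: braid_words_def)
  then have *: "\<Delta> (n, u @ [i] @ v) - \<Delta> (n, u @ [- i] @ v) =
        (Poly_Mapping.single 1 1 - Poly_Mapping.single (- 1) 1) * \<Delta> (n, u @ v)"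
    using assms by (simp add: alexander_polynomial_def)
  show ?thesis
  proof (cases "e = 1")
    case True
    then show ?thesis using * by simp
  next
    case False
    then have "e = - 1" using assms by auto
    then show ?thesis using * by (simp add: single_uminus algebra_simps)
  qed
qed

text \<open>In a block of \<open>m + 2\<close> letters, changing the last crossing lets it cancel
  against its neighbour, and deleting it leaves \<open>m + 1\<close> letters. This is the recursion
  of \<open>skein_seq\<close>.\<close>

lemma alexander_append_block:
  assumes A: "alexander_polynomial \<Delta>" and w: "w \<in> braid_words n" and n: "n \<ge> 1"
    and e: "e \<in> {1, - 1}"
  shows "\<Delta> (Suc n, w @ replicate m (e * int n)) =
    skein_seq (Poly_Mapping.single 1 e - Poly_Mapping.single (- 1) e) m * \<Delta> (n, w)"
proof -
  let ?z = "Poly_Mapping.single 1 e - Poly_Mapping.single (- 1) e :: laurent"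
  have bw: "w @ replicate m (e * int n) \<in> braid_words (Suc n)" for m
    using w n e by (fastforce simp: braid_words_def)
  have bw1: "w @ [e * int n] @ [] \<in> braid_words (Suc n)"
    using bw[of 1] by simp
  have stab: "\<Delta> (Suc n, w @ [d * int n]) = \<Delta> (n, w)" if "d \<in> {1, - 1}" for d
    using alexander_markov_move[OF A markov_move.stabilize[OF w n that]] by simp
  \<comment> \<open>Stabilizations of opposite sign give isotopic links, so \<open>?z\<close> annihilates the split link.\<close>
  have split: "\<Delta> (Suc n, w) = 0"
  proof -
    have "?z * \<Delta> (Suc n, w) = 0"
      using alexander_skein[OF A bw1 _ e] n stab[of e] stab[of "- e"] e by auto
    \<comment> \<open>The coefficient of \<open>?z\<close> at exponent 1 is \<open>e\<close>; the
      Laurent ring has no zero divisors.\<close>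
    moreover have "?z \<noteq> 0"
    proof
      assume "?z = 0"
      then have "Poly_Mapping.lookup ?z 1 = 0" by simp
      then show False using e by (auto simp: lookup_minus lookup_single)
    qed
    ultimately show ?thesis by simp
  qed
  show ?thesis
  proof (induction m rule: induct_nat_012)
    case 0
    show ?case by (simp add: split)
  next
    case 1
    show ?case using stab[OF e] by simp
  next
    case (ge2 m)
    let ?g = "e * int n"
    let ?u = "w @ replicate (Suc m) ?g"
    have rep: "?u @ [?g] @ [] = w @ replicate (Suc (Suc m)) ?g"
      by (simp add: replicate_append_same)
    have "?u @ [?g] @ [] \<in> braid_words (Suc n)"
      unfolding rep by (rule bw)
    from alexander_skein[OF A this _ e] n
    have *: "\<Delta> (Suc n, w @ replicate (Suc (Suc m)) ?g) - \<Delta> (Suc n, ?u @ [- ?g]) = ?z * \<Delta> (Suc n, ?u)"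
      unfolding rep by simp
    have u: "?u @ [- ?g] = (w @ replicate m ?g) @ [?g, - ?g] @ []"
      by (simp add: replicate_append_same)
    have "(w @ replicate m ?g) @ [?g, - ?g] @ [] \<in> braid_words (Suc n)"
      using bw[of "Suc m"] by (auto simp: braid_words_def)
    from alexander_markov_move[OF A markov_move.cancel[OF this]]
    have "\<Delta> (Suc n, ?u @ [- ?g]) = \<Delta> (Suc n, w @ replicate m ?g)"
      unfolding u by simp
    with * ge2.IH show ?case by (simp add: algebra_simps)
  qed
qed

text \<open>Blocks are stripped from the right, each time dropping one strand, until the unknot on
  one strand remains.\<close>

lemma alexander_three_blocks:
  assumes A: "alexander_polynomial \<Delta>" and "p > 0" "q > 0" "r > 0"
  shows "\<exists>e k. e \<in> {1, - 1} \<and>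
    \<Delta> (4, replicate p 1 @ replicate q (- 2) @ replicate r 3) =
      Poly_Mapping.single k e * at_minus_t (q_bracket p * q_bracket q * q_bracket r)"
proof -
  obtain p' q' r' where [simp]: "p = Suc p'" "q = Suc q'" "r = Suc r'"
    using assms by (metis gr0_implies_Suc)
  let ?z = "\<lambda>e. Poly_Mapping.single 1 e - Poly_Mapping.single (- 1) e :: laurent"
  let ?w = "replicate p 1 @ replicate q (- 2)"
  have w: "?w \<in> braid_words 3" "replicate p 1 \<in> braid_words 2"
    by (auto simp: braid_words_def)
  have "\<Delta> (4, ?w @ replicate r 3) = skein_seq (?z 1) r * \<Delta> (3, ?w)"
    using alexander_append_block[OF A w(1), of 1 r] by simp
  also have "\<Delta> (3, ?w) = skein_seq (?z (- 1)) q * \<Delta> (2, replicate p 1)"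
    using alexander_append_block[OF A w(2), of "- 1" q] by simp
  also have "\<Delta> (2, replicate p 1) = skein_seq (?z 1) p * \<Delta> (1, [])"
    using alexander_append_block[OF A, of "[]" 1 1 p] by (simp add: braid_words_def numeral_2_eq_2)
  also have "\<Delta> (1, []) = 1"
    using A by (simp add: alexander_polynomial_def)
  \<comment> \<open>The middle block has \<open>e = - 1\<close>, hence
    \<open>(- e) ^ q' = 1\<close>: only the outer blocks contribute signs.\<close>
  finally have "\<Delta> (4, ?w @ replicate r 3) =
      Poly_Mapping.single (- int p' - (int q' + int r')) ((- 1) ^ p' * (- 1) ^ r') *
      at_minus_t (q_bracket p * q_bracket q * q_bracket r)"
    by (simp add: skein_seq_eq_q_bracket at_minus_t_mult mult_single algebra_simps
        del: skein_seq.simps)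
  moreover have "(- 1) ^ p' * (- 1) ^ r' \<in> {1, - 1 :: int}"
    by (simp add: minus_one_power_iff)
  ultimately show ?thesis by auto
qed

section \<open>Products of three brackets\<close>

lemma lookup_mult_q_bracket:
  "Poly_Mapping.lookup (f * q_bracket n) k = (\<Sum>j<n. Poly_Mapping.lookup f (k - int j))"
proof -
  have *: "Poly_Mapping.lookup (f * Poly_Mapping.single j 1) k = Poly_Mapping.lookup f (k - j)" for j
  proof -
    have "Poly_Mapping.lookup (f * Poly_Mapping.single j 1) k =
        (\<Sum>i\<in>Poly_Mapping.keys f. Poly_Mapping.lookup
          (Poly_Mapping.single i (Poly_Mapping.lookup f i) * Poly_Mapping.single j 1) k)"
      by (subst (1) poly_mapping_sum_singles[of f, symmetric])
         (simp add: sum_distrib_right lookup_sum)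
    also have "\<dots> = (\<Sum>i\<in>Poly_Mapping.keys f. if i = k - j then Poly_Mapping.lookup f i else 0)"
      by (intro sum.cong refl) (auto simp: mult_single lookup_single when_def)
    also have "\<dots> = Poly_Mapping.lookup f (k - j)"
      by (simp add: in_keys_iff)
    finally show ?thesis .
  qed
  show ?thesis
    by (simp add: q_bracket_def sum_distrib_left lookup_sum *)
qed

lemma lookup_q_bracket:
  "Poly_Mapping.lookup (q_bracket n) k = (if 0 \<le> k \<and> k < int n then 1 else 0)"
proof -
  have "Poly_Mapping.lookup (q_bracket n) k = (\<Sum>j<n. if j = nat k \<and> 0 \<le> k then 1 else 0)"
    unfolding q_bracket_def lookup_sum
    by (intro sum.cong refl) (auto simp: lookup_single when_def)
  also have "\<dots> = (if 0 \<le> k \<and> k < int n then 1 else 0)"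
    by auto
  finally show ?thesis .
qed

text \<open>The value counts the pairs of exponents, one below \<open>x\<close> and one below
  \<open>y\<close>, with sum \<open>k\<close>: a ramp of slope 1, a plateau and a descent. The outer
  \<open>max\<close> covers all \<open>k\<close> outside the support.\<close>

lemma lookup_q_bracket_mult_q_bracket:
  "Poly_Mapping.lookup (q_bracket x * q_bracket y) k =
     max 0 (min (min (k + 1) (int x + int y - 1 - k)) (min (int x) (int y)))"
proof -
  have "Poly_Mapping.lookup (q_bracket x * q_bracket y) k =
      (\<Sum>j<y. if 0 \<le> k - int j \<and> k - int j < int x then 1 else 0)"
    by (simp add: lookup_mult_q_bracket lookup_q_bracket)
  also have "\<dots> = max 0 (min (min (k + 1) (int x + int y - 1 - k)) (min (int x) (int y)))"
  proof (induction y)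
    case (Suc y)
    show ?case
      unfolding sum.lessThan_Suc Suc.IH by (simp add: min_def max_def)
  qed (auto simp: min_def max_def)
  finally show ?thesis .
qed

section \<open>Sliding windows and the stable part\<close>

lemma sum_shift_difference:
  fixes b :: "int \<Rightarrow> int"
  shows "(\<Sum>j<n. b (k + 1 - int j)) - (\<Sum>j<n. b (k - int j)) = b (k + 1) - b (k + 1 - int n)"
  by (induction n) (simp_all add: algebra_simps)

text \<open>Symmetry turns the ascents before \<open>i\<close> into descents after
  \<open>n - i\<close>. A constant run contains none of these strict steps, so none is longer than
  the plateau. The ascents also carry positivity from \<open>a 0\<close> to all
  coefficients.\<close>

lemma stable_part_lengthI:
  assumes "presented f s n a" "symmetric_coeffs n a" "a 0 > 0" "i \<le> n - i"
    and up: "\<And>k. k < i \<Longrightarrow> a k < a (k + 1)"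
    and flat: "\<And>k. i \<le> k \<Longrightarrow> k < n - i \<Longrightarrow> a k = a (k + 1)"
  shows "stable_part_length f (n - 2 * i)"
proof -
  have sym: "a k = a (n - k)" if "k \<le> n" for k
    using assms(2) that unfolding symmetric_coeffs_def by blast
  have down: "a k > a (k + 1)" if "n - i \<le> k" "k < n" for k
  proof -
    have "n - k = n - (k + 1) + 1" "n - (k + 1) < i" using that by auto
    then have "a (n - (k + 1)) < a (n - k)" using up by metis
    then show ?thesis using sym[of k] sym[of "k + 1"] that by simp
  qed
  have trap: "trapezoidal_coeffs n a"
    unfolding trapezoidal_coeffs_def
    by (rule exI[of _ i], rule exI[of _ "n - i"]) (use assms down in auto)
  have const: "a (i + j) = a i" if "j \<le> n - 2 * i" for j
    using that
  proof (induction j)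
    case (Suc j)
    then show ?case using flat[of "i + j"] by simp
  qed simp
  have left: "a k > 0" if "k \<le> i" for k
    using that
  proof (induction k)
    case (Suc k)
    then show ?case using up[of k] by simp
  qed (use assms in simp)
  have pos: "a k > 0" if "k \<le> n" for k
  proof -
    consider "k \<le> i" | "i < k" "k \<le> n - i" | "n - i < k" by linarith
    then show ?thesis
    proof cases
      case 2
      then show ?thesis using const[of "k - i"] left[of i] by simp
    next
      case 3
      then show ?thesis using sym[OF that] left[of "n - k"] by simp
    qed (rule left)
  qed
  have "constant_run n a (n - 2 * i)"
    unfolding constant_run_def using const assms(4) by (intro exI[of _ i]) auto
  moreover have "m \<le> n - 2 * i" if "constant_run n a m" for m
  proof (cases "m = 0")
    case False
    obtain k where k: "k + m \<le> n" "\<And>j. j \<le> m \<Longrightarrow> a (k + j) = a k"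
      using \<open>constant_run n a m\<close> by (auto simp: constant_run_def)
    have "i \<le> k"
      using up[of k] k(2)[of 1] False by force
    moreover have "k + m \<le> n - i"
    proof (rule ccontr)
      assume "\<not> k + m \<le> n - i"
      then have "a (k + m - 1) > a (k + m - 1 + 1)" using down[of "k + m - 1"] k(1) False by simp
      moreover have "a (k + m - 1) = a k" using k(2)[of "m - 1"] False by simp
      moreover have "a (k + m - 1 + 1) = a k" using k(2)[of m] False by simp
      ultimately show False by simp
    qed
    ultimately show ?thesis by linarith
  qed simp
  ultimately show ?thesis
    unfolding stable_part_length_def using assms(1,2) trap pos
    by (intro exI[of _ s] exI[of _ n] exI[of _ a]) (simp add: less_imp_neq[THEN not_sym])
qed

lemma stable_part_length_imp_trapezoidal: "stable_part_length f l \<Longrightarrow> trapezoidal f"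
  unfolding stable_part_length_def trapezoidal_def by blast

text \<open>\<open>N\<close> is the degree. The ascent ends at \<open>x + y - 2\<close>, where the
  window of length \<open>z\<close> covers the support of the product of the first two brackets, or
  at the middle if that comes first.\<close>

lemma stable_part_length_three_q_brackets:
  assumes "x > 0" "y > 0" "x \<le> z" "y \<le> z"
  defines "N \<equiv> x + y + z - 3"
  shows "stable_part_length (q_bracket x * q_bracket y * q_bracket z)
    (N - 2 * min (x + y - 2) (N div 2))"
proof -
  let ?F = "q_bracket x * q_bracket y * q_bracket z"
  let ?i = "min (x + y - 2) (N div 2)"
  define b where "b k = max 0 (min (min (k + 1) (int x + int y - 1 - k)) (min (int x) (int y)))" for k
  define a where "a k = Poly_Mapping.lookup ?F k" for k
  have N: "int N = int x + int y + int z - 3" using assms by auto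
  have a: "a k = (\<Sum>j<z. b (k - int j))" for k
    by (simp add: a_def b_def lookup_mult_q_bracket[of _ z] lookup_q_bracket_mult_q_bracket)
  have diff: "a (k + 1) - a k = b (k + 1) - b (k + 1 - int z)" for k
    unfolding a by (rule sum_shift_difference)
  have b_sym: "b k = b (int x + int y - 2 - k)" for k
    unfolding b_def by (simp add: min.commute algebra_simps)
  have a_sym: "a k = a (int N - k)" for k
  proof -
    \<comment> \<open>The window is read backwards, so that reflecting \<open>b\<close> in its own
      centre reflects \<open>a\<close> in \<open>N / 2\<close>.\<close>
    have "a k = (\<Sum>j<z. b (k - int (z - Suc j)))"
      unfolding a by (rule sum.nat_diff_reindex[symmetric])
    also have "\<dots> = (\<Sum>j<z. b (int N - k - int j))"
    proof (rule sum.cong[OF refl])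
      fix j assume "j \<in> {..<z}"
      then have "int N - k - int j = int x + int y - 2 - (k - int (z - Suc j))"
        using N by auto
      then show "b (k - int (z - Suc j)) = b (int N - k - int j)"
        by (simp only: b_sym[symmetric])
    qed
    finally show ?thesis by (simp add: a)
  qed
  have b_outside: "b k = 0" if "k < 0 \<or> k > int x + int y - 2" for k
    using that by (auto simp: b_def)
  have a_neg: "a k = 0" if "k < 0" for k
    unfolding a using that by (intro sum.neutral) (auto intro: b_outside)
  have a_large: "a k = 0" if "k > int N" for k
    using a_neg[of "int N - k"] a_sym[of k] that by simp
  \<comment> \<open>The step from index -1, where \<open>a\<close> vanishes, to 0 raises
    \<open>a\<close> by \<open>b 0 = 1\<close>.\<close>
  have a_0: "a 0 > 0"
    using diff[of "- 1"] a_neg[of "- 1"] assms by (simp add: b_def)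
  show ?thesis
  proof (rule stable_part_lengthI[where s = 0 and a = "\<lambda>k. a (int k)"])
    show "presented ?F 0 N (\<lambda>k. a (int k))"
      unfolding presented_def
    proof (rule poly_mapping_eqI)
      fix k
      have "(\<Sum>j\<le>N. Poly_Mapping.lookup (Poly_Mapping.single (int j + 0) (a (int j))) k) =
          (\<Sum>j\<le>N. if j = nat k then (if 0 \<le> k then a k else 0) else 0)"
        by (intro sum.cong refl) (auto simp: lookup_single when_def)
      also have "\<dots> = a k"
        using a_neg[of k] a_large[of k] by auto
      finally show "Poly_Mapping.lookup ?F k =
          Poly_Mapping.lookup (\<Sum>j\<le>N. Poly_Mapping.single (int j + 0) (a (int j))) k"
        by (simp add: lookup_sum a_def)
    qed
    show "symmetric_coeffs N (\<lambda>k. a (int k))"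
      using a_sym by (simp add: symmetric_coeffs_def of_nat_diff)
    show "a (int 0) > 0" using a_0 by simp
    show "?i \<le> N - ?i" by linarith
    show "a (int k) < a (int (k + 1))" if "k < ?i" for k
    proof -
      have "k + 1 \<le> x + y - 2" "2 * k + 2 \<le> N"
        using that by auto
      then have k: "int k + 1 \<le> int x + int y - 2" "2 * int k + 2 \<le> int N"
        by linarith+
      \<comment> \<open>The smaller value lies under the rising ramp cut off at 0, which is below
        each of the four quantities in the minimum for the larger one. The comparisons with
        \<open>x\<close> and \<open>y\<close> use that \<open>z\<close> is largest.\<close>
      have "b (int k + 1) > b (int k + 1 - int z)"
      proof -
        have "b (int k + 1 - int z) \<le> max 0 (int k + 2 - int z)"
          unfolding b_def by (intro max.mono order_refl min.coboundedI1) simp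
        also have "\<dots> < min (min (int k + 2) (int x + int y - 2 - int k)) (min (int x) (int y))"
          unfolding min_less_iff_conj max_less_iff_conj using k N assms(1-4) by (intro conjI) linarith+
        also have "\<dots> \<le> b (int k + 1)"
          unfolding b_def by (simp add: algebra_simps)
        finally show ?thesis .
      qed
      then show ?thesis using diff[of "int k"] by (simp add: add.commute)
    qed
    show "a (int k) = a (int (k + 1))" if "?i \<le> k" "k < N - ?i" for k
    proof -
      have "b (int k + 1) = b (int k + 1 - int z)"
      proof (cases "x + y - 2 \<le> N div 2")
        \<comment> \<open>The window covers the support of \<open>b\<close>: both values that enter
          or leave it are zero.\<close>
        case True
        then have "x + y - 2 \<le> k" "k < N - (x + y - 2)" using that by auto
        then have "int k + 1 > int x + int y - 2" "int k + 1 - int z < 0"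
          using N assms(1-4) by linarith+
        then show ?thesis by (simp add: b_outside)
      next
        \<comment> \<open>Such a \<open>k\<close> exists only for odd \<open>N\<close>; then
          \<open>k\<close> and \<open>k + 1\<close> are the middle indices and the two arguments of
          \<open>b\<close> are mirror images.\<close>
        case False
        then have "N div 2 \<le> k" "k < N - N div 2" using that by auto
        then have "2 * int k + 2 = int N + 1" by linarith
        then have "int k + 1 - int z = int x + int y - 2 - (int k + 1)" using N by simp
        then show ?thesis by (simp only: b_sym[symmetric])
      qed
      then show ?thesis using diff[of "int k"] by (simp add: add.commute)
    qed
  qed
qed

text \<open>The bound is the absolute value of the signature computed below. A largest exponent
  takes the role of \<open>z\<close>.\<close>

lemma stable_part_length_le:
  assumes "p > 0" "q > 0" "r > 0"
  shows "\<exists>l. stable_part_length (q_bracket p * q_bracket q * q_bracket r) l \<and>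
    int l \<le> \<bar>int q + 1 - int p - int r\<bar>"
proof -
  define N where "N = p + q + r - 3"
  have N: "int N = int p + int q + int r - 3" using assms by (auto simp: N_def)
  \<comment> \<open>\<open>m\<close> will be the degree of the product of the other two brackets. If
    the ascent reaches the middle instead, the length is \<open>N mod 2\<close>.\<close>
  have bound: "int (N - 2 * min m (N div 2)) \<le> \<bar>int q + 1 - int p - int r\<bar>"
    if "int N - 2 * int m \<le> \<bar>int q + 1 - int p - int r\<bar>" for m
  proof (cases "m \<le> N div 2")
    case True
    then have "2 * m \<le> N" by linarith
    with True that show ?thesis by simp
  next
    case False
    then have "N - 2 * min m (N div 2) = N mod 2"
      by (simp add: minus_mult_div_eq_mod)
    \<comment> \<open>\<open>N\<close> and \<open>q + 1 - p - r\<close> have the same parity, so the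
      right-hand side is nonzero for odd \<open>N\<close>.\<close>
    moreover have "int N mod 2 \<le> \<bar>int q + 1 - int p - int r\<bar>"
    proof (cases "int N mod 2 = 0")
      case False
      then have "int q + 1 - int p - int r \<noteq> 0" using N by presburger
      then show ?thesis by linarith
    qed simp
    ultimately show ?thesis by (metis of_nat_mod of_nat_numeral)
  qed
  consider "p \<le> r" "q \<le> r" | "p \<le> q" "r \<le> q" | "q \<le> p" "r \<le> p" by linarith
  then show ?thesis
  proof cases
    case 1
    have "stable_part_length (q_bracket p * q_bracket q * q_bracket r) (N - 2 * min (p + q - 2) (N div 2))"
      using stable_part_length_three_q_brackets[of p q r] assms 1 by (simp add: N_def)
    \<comment> \<open>The left-hand side is \<open>r + 1 - p - q\<close>, at most
      \<open>p + r - q - 1\<close> because \<open>p > 0\<close>.\<close>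
    moreover have "int N - 2 * int (p + q - 2) \<le> \<bar>int q + 1 - int p - int r\<bar>"
      using N assms by linarith
    ultimately show ?thesis using bound by blast
  next
    case 2
    have "stable_part_length (q_bracket p * q_bracket q * q_bracket r) (N - 2 * min (p + r - 2) (N div 2))"
      using stable_part_length_three_q_brackets[of p r q] assms 2 by (simp add: N_def ac_simps)
    moreover have "int N - 2 * int (p + r - 2) \<le> \<bar>int q + 1 - int p - int r\<bar>"
      using N assms by linarith
    ultimately show ?thesis using bound by blast
  next
    case 3
    have "stable_part_length (q_bracket p * q_bracket q * q_bracket r) (N - 2 * min (q + r - 2) (N div 2))"
      using stable_part_length_three_q_brackets[of q r p] assms 3 by (simp add: N_def ac_simps)
    moreover have "int N - 2 * int (q + r - 2) \<le> \<bar>int q + 1 - int p - int r\<bar>"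
      using N assms by linarith
    ultimately show ?thesis using bound by blast
  qed
qed

section \<open>The signature\<close>

definition root_count :: "(real \<Rightarrow> bool) \<Rightarrow> real poly \<Rightarrow> nat" where
  "root_count Q f = (\<Sum>x | Q x \<and> poly f x = 0. order x f)"

lemma root_count_superset:
  assumes "f \<noteq> 0" "finite S" "{x. Q x \<and> poly f x = 0} \<subseteq> S" "\<forall>x\<in>S. Q x"
  shows "root_count Q f = (\<Sum>x\<in>S. order x f)"
  unfolding root_count_def
  by (rule sum.mono_neutral_left) (use assms in \<open>auto simp: order_root\<close>)

text \<open>Orders of vanishing add. Summing over the union of both root sets is harmless, since the
  order at a nonroot is 0.\<close>

lemma root_count_mult:
  assumes "f \<noteq> 0" "g \<noteq> 0"
  shows "root_count Q (f * g) = root_count Q f + root_count Q g"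
proof -
  let ?S = "{x. Q x \<and> poly f x = 0} \<union> {x. Q x \<and> poly g x = 0}"
  have fin: "finite ?S"
    using poly_roots_finite[OF assms(1)] poly_roots_finite[OF assms(2)] by auto
  have "root_count Q h = (\<Sum>x\<in>?S. order x h)" if "h \<in> {f, g, f * g}" for h
    using that fin assms by (intro root_count_superset) auto
  then show ?thesis
    using assms by (simp add: order_mult sum.distrib)
qed

lemma root_count_linear: "root_count Q [:- a, 1:] = (if Q a then 1 else 0)"
proof -
  have "{x. Q x \<and> poly [:- a, 1:] x = 0} = (if Q a then {a} else {})" by auto
  then show ?thesis
    using order_power_n_n[of a 1] by (simp add: root_count_def)
qed

lemma root_count_prod_linear:
  "finite S \<Longrightarrow> root_count Q (\<Prod>a\<in>S. [:- a, 1:]) = card {a \<in> S. Q a}"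
proof (induction S rule: finite_induct)
  case empty
  show ?case by (simp add: root_count_def)
next
  case (insert a S)
  have "(\<Prod>a\<in>S. [:- a, 1:]) \<noteq> 0" using insert(1) by auto
  moreover have "{b \<in> insert a S. Q b} = (if Q a then insert a {b \<in> S. Q b} else {b \<in> S. Q b})"
    by auto
  ultimately show ?case
    using insert
    by (simp add: root_count_mult root_count_linear del: mult_pCons_left)
qed

lemma prod_linear_factors_dvd:
  fixes f :: "'a :: field poly"
  assumes "finite S" "\<And>a. a \<in> S \<Longrightarrow> poly f a = 0"
  shows "(\<Prod>a\<in>S. [:- a, 1:]) dvd f"
  using assms
proof (induction S rule: finite_induct)
  case (insert a S)
  then obtain g where g: "f = (\<Prod>a\<in>S. [:- a, 1:]) * g" by (auto elim: dvdE)
  have "poly (\<Prod>a\<in>S. [:- a, 1:]) a \<noteq> 0"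
    using insert by (auto simp: poly_prod)
  then have "poly g a = 0" using insert.prems[of a] g by simp
  then have "[:- a, 1:] dvd g" by (simp add: poly_eq_0_iff_dvd)
  then have "[:- a, 1:] * (\<Prod>a\<in>S. [:- a, 1:]) dvd g * (\<Prod>a\<in>S. [:- a, 1:])"
    by (rule mult_dvd_mono) simp
  then show ?case unfolding g prod.insert[OF insert(1,2)] by (simp only: mult.commute)
qed simp

text \<open>The product of linear factors divides the characteristic polynomial; both are monic of
  degree \<open>n\<close>, so the cofactor is 1.\<close>

lemma char_poly_distinct_eigenvalues:
  fixes A :: "'a :: field mat"
  assumes A: "A \<in> carrier_mat n n" and S: "finite S" "card S = n"
    and ev: "\<And>a. a \<in> S \<Longrightarrow> eigenvalue A a"
  shows "char_poly A = (\<Prod>a\<in>S. [:- a, 1:])"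
proof -
  let ?P = "\<Prod>a\<in>S. [:- a, 1:]"
  have deg: "degree (char_poly A) = n" "coeff (char_poly A) n = 1"
    using degree_monic_char_poly[OF A] by auto
  have P: "degree ?P = n" using S by (simp add: degree_prod_eq_sum_degree)
  have P1: "lead_coeff ?P = 1" by (subst lead_coeff_prod) simp
  have "?P dvd char_poly A"
    using S ev eigenvalue_root_char_poly[OF A] by (intro prod_linear_factors_dvd) auto
  then obtain g where g: "char_poly A = ?P * g" by (elim dvdE)
  have "g \<noteq> 0" "?P \<noteq> 0" using g deg P1 by auto
  then have "degree g = 0"
    using g deg P degree_mult_eq[of ?P g] by simp
  then obtain c where c: "g = [:c:]" by (rule degree_eq_zeroE)
  have "lead_coeff (char_poly A) = lead_coeff ?P * lead_coeff g"
    unfolding g by (rule lead_coeff_mult)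
  then have "c = 1" using deg P1 c by simp
  then show ?thesis using g c by simp
qed

lemma char_poly_block_diag:
  fixes A B :: "'a :: idom mat"
  assumes A: "A \<in> carrier_mat n n" and B: "B \<in> carrier_mat m m"
  shows "char_poly (four_block_mat A (0\<^sub>m n m) (0\<^sub>m m n) B) = char_poly A * char_poly B"
proof -
  have "char_poly_matrix (four_block_mat A (0\<^sub>m n m) (0\<^sub>m m n) B) =
      four_block_mat (char_poly_matrix A) (0\<^sub>m n m) (0\<^sub>m m n) (char_poly_matrix B)"
    by (rule eq_matI) (use A B in \<open>auto simp: char_poly_matrix_def\<close>)
  then show ?thesis
    unfolding char_poly_def
    using A B by (simp add: det_four_block_mat_lower_left_zero[of _ n _ m])
qed

text \<open>Eigenvalues are roots of the characteristic polynomial, so the signature can be read off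
  from its factorization.\<close>

lemma matrix_signature_root_count:
  assumes "A \<in> carrier_mat n n"
  shows "matrix_signature A =
    int (root_count (\<lambda>x. x > 0) (char_poly A)) - int (root_count (\<lambda>x. x < 0) (char_poly A))"
  by (simp add: matrix_signature_def root_count_def eigenvalue_root_char_poly[OF assms])

lemma matrix_signature_block_diag:
  assumes A: "A \<in> carrier_mat n n" and B: "B \<in> carrier_mat m m"
  shows "matrix_signature (four_block_mat A (0\<^sub>m n m) (0\<^sub>m m n) B) =
    matrix_signature A + matrix_signature B"
proof -
  have "char_poly A \<noteq> 0" "char_poly B \<noteq> 0"
    using degree_monic_char_poly[OF A] degree_monic_char_poly[OF B] by auto
  moreover have AB: "four_block_mat A (0\<^sub>m n m) (0\<^sub>m m n) B \<in> carrier_mat (n + m) (n + m)"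
    using A B by auto
  ultimately show ?thesis
    unfolding matrix_signature_root_count[OF A] matrix_signature_root_count[OF B]
      matrix_signature_root_count[OF AB]
    using A B by (simp add: char_poly_block_diag root_count_mult)
qed

section \<open>Spectrum of Cartan matrices of type A\<close>

lemma cartan_angle_bounds:
  assumes "k \<in> {1..n}"
  shows "0 < real k * pi / real (n + 1)" "real k * pi / real (n + 1) < pi"
proof -
  show "0 < real k * pi / real (n + 1)" using assms by simp
  have "real k * pi < real (n + 1) * pi"
    using assms by (intro mult_strict_right_mono) auto
  then show "real k * pi / real (n + 1) < pi"
    by (subst pos_divide_less_eq) (auto simp: mult.commute)
qed

text \<open>For \<open>e\<close> equal to 1 or -1, this is the symmetrized Seifert matrix of a block
  of \<open>n + 1\<close> equal letters of sign \<open>- e\<close>.\<close>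

definition cartan_mat :: "real \<Rightarrow> nat \<Rightarrow> real mat" where
  "cartan_mat e n = mat n n (\<lambda>(i, j). if i = j then 2 * e else if i = Suc j \<or> j = Suc i then - e else 0)"

lemma cartan_mat_carrier [simp]: "cartan_mat e n \<in> carrier_mat n n"
  by (simp add: cartan_mat_def)

text \<open>The vector with entries \<open>sin ((j + 1) \<theta>)\<close> satisfies the boundary conditions iff
  \<open>sin ((n + 1) \<theta>) = 0\<close>.\<close>

lemma eigenvalue_cartan_mat:
  assumes k: "k \<in> {1..n}"
  defines "\<theta> \<equiv> real k * pi / real (n + 1)"
  shows "eigenvalue (cartan_mat e n) (e * (2 - 2 * cos \<theta>))"
proof -
  define s where "s m = sin (real m * \<theta>)" for m
  let ?v = "vec n (\<lambda>j. s (Suc j))"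
  have "0 < \<theta>" "\<theta> < pi" unfolding \<theta>_def by (rule cartan_angle_bounds[OF k])+
  then have "s 1 \<noteq> 0" using sin_gt_zero[of \<theta>] by (simp add: s_def)
  then have "?v $ 0 \<noteq> 0\<^sub>v n $ 0" using k by simp
  then have "?v \<noteq> 0\<^sub>v n" by metis
  moreover have "cartan_mat e n *\<^sub>v ?v = (e * (2 - 2 * cos \<theta>)) \<cdot>\<^sub>v ?v"
  proof (rule eq_vecI)
    fix i assume "i < dim_vec ((e * (2 - 2 * cos \<theta>)) \<cdot>\<^sub>v ?v)"
    then have i: "i < n" by simp
    \<comment> \<open>The zeros \<open>s 0\<close> and \<open>s (Suc n)\<close> stand for the
      missing neighbours of the first and last entries.\<close>
    have s0: "s 0 = 0" by (simp add: s_def)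
    have sn: "s (Suc n) = 0"
    proof -
      have "real (Suc n) * \<theta> = real k * pi" by (simp add: \<theta>_def)
      then show ?thesis by (simp add: s_def)
    qed
    have trig: "s i + s (Suc (Suc i)) = 2 * cos \<theta> * s (Suc i)"
    proof -
      have "real i * \<theta> = real (Suc i) * \<theta> - \<theta>" "real (Suc (Suc i)) * \<theta> = real (Suc i) * \<theta> + \<theta>"
        by (simp_all add: algebra_simps)
      then show ?thesis by (simp only: s_def sin_diff sin_add) simp
    qed
    have "(cartan_mat e n *\<^sub>v ?v) $ i =
        (\<Sum>j<n. (if j = i then 2 * e * s (Suc j) else 0) +
          ((if Suc j = i then - e * s (Suc j) else 0) + (if j = Suc i then - e * s (Suc j) else 0)))"
      using i by (simp add: cartan_mat_def scalar_prod_def lessThan_atLeast0)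
         (intro sum.cong, auto)
    also have "\<dots> = 2 * e * s (Suc i) + ((\<Sum>j<n. if Suc j = i then - e * s (Suc j) else 0) +
        (\<Sum>j<n. if j = Suc i then - e * s (Suc j) else 0))"
      using i by (simp add: sum.distrib)
    also have "(\<Sum>j<n. if Suc j = i then - e * s (Suc j) else 0) = - e * s i"
    proof (cases i)
      case (Suc i')
      then have "(\<Sum>j<n. if Suc j = i then - e * s (Suc j) else 0) =
          (\<Sum>j<n. if j = i' then - e * s (Suc j) else 0)"
        by (intro sum.cong) auto
      then show ?thesis using Suc i by simp
    qed (simp add: s0)
    also have "(\<Sum>j<n. if j = Suc i then - e * s (Suc j) else 0) = - e * s (Suc (Suc i))"
      using i sn by (cases "Suc i = n") auto
    also have "2 * e * s (Suc i) + (- e * s i + - e * s (Suc (Suc i))) =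
        e * (2 * s (Suc i) - (s i + s (Suc (Suc i))))"
      by (simp add: algebra_simps)
    also have "\<dots> = e * (2 - 2 * cos \<theta>) * s (Suc i)"
      unfolding trig by (simp add: algebra_simps)
    finally show "(cartan_mat e n *\<^sub>v ?v) $ i = ((e * (2 - 2 * cos \<theta>)) \<cdot>\<^sub>v ?v) $ i"
      using i by simp
  qed (simp add: cartan_mat_def)
  ultimately show ?thesis
    unfolding eigenvalue_def eigenvector_def
    by (intro exI[of _ ?v]) (simp add: cartan_mat_def)
qed

text \<open>Cosine is injective between 0 and pi, so the \<open>n\<close> known eigenvalues are
  distinct, hence simple and the only ones. The factor of \<open>e\<close> in each is
  positive.\<close>

lemma matrix_signature_cartan_mat:
  assumes "e \<noteq> 0"
  shows "matrix_signature (cartan_mat e n) = (if e > 0 then int n else - int n)"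
proof -
  let ?l = "\<lambda>k. e * (2 - 2 * cos (real k * pi / real (n + 1)))"
  define S where "S = ?l ` {1..n}"
  have "inj_on ?l {1..n}"
  proof (rule inj_onI)
    fix j k assume jk: "j \<in> {1..n}" "k \<in> {1..n}" "?l j = ?l k"
    then have "cos (real j * pi / real (n + 1)) = cos (real k * pi / real (n + 1))"
      using assms by simp
    then have "real j * pi / real (n + 1) = real k * pi / real (n + 1)"
      using cartan_angle_bounds[OF jk(1)] cartan_angle_bounds[OF jk(2)]
      by (metis cos_inj_pi less_imp_le)
    then show "j = k" by simp
  qed
  then have card: "finite S" "card S = n" unfolding S_def by (simp_all add: card_image del: of_nat_add)
  have ev: "char_poly (cartan_mat e n) = (\<Prod>a\<in>S. [:- a, 1:])"
    using eigenvalue_cartan_mat[of _ n e] card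
    by (intro char_poly_distinct_eigenvalues[of _ n]) (auto simp: S_def)
  have pos: "2 - 2 * cos (real k * pi / real (n + 1)) > 0" if "k \<in> {1..n}" for k
  proof -
    have "cos (real k * pi / real (n + 1)) < cos 0"
      using cartan_angle_bounds[OF that] by (intro cos_monotone_0_pi) auto
    then show ?thesis by simp
  qed
  have "(a > 0 \<longleftrightarrow> e > 0) \<and> (a < 0 \<longleftrightarrow> \<not> e > 0)" if a: "a \<in> S" for a
  proof -
    obtain k where "k \<in> {1..n}" "a = ?l k" using a unfolding S_def by blast
    then show ?thesis
      using pos[of k] assms by (auto simp: zero_less_mult_iff mult_less_0_iff)
  qed
  then have "{a \<in> S. a > 0} = (if e > 0 then S else {})" "{a \<in> S. a < 0} = (if e > 0 then {} else S)"
    by (auto split: if_splits)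
  then show ?thesis
    by (simp add: matrix_signature_root_count[of _ n] ev root_count_prod_linear card)
qed

section \<open>The Seifert matrix of the closed braid\<close>

lemma filter_product:
  "filter P (List.product xs ys) = concat (map (\<lambda>x. map (Pair x) (filter (\<lambda>y. P (x, y)) ys)) xs)"
  by (induction xs) (simp_all add: filter_map o_def)

lemma filter_eq_upt: "filter (\<lambda>l. l = a) [0..<n] = (if a < n then [a] else [])"
  by (induction n) auto

lemma concat_map_if_singleton:
  "concat (map (\<lambda>x. if P x then [f x] else []) xs) = map f (filter P xs)"
  by (induction xs) auto

text \<open>\<open>\<kappa> a\<close> skips the last letter of each block, at which no loop starts.\<close>

lemma seifert_loops_three_blocks:
  fixes p q r :: nat
  defines "w \<equiv> replicate (Suc p) 1 @ replicate (Suc q) (- 2) @ replicate (Suc r) 3"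
    and "\<kappa> \<equiv> \<lambda>a. if a < p then a else if a < p + q then a + 1 else a + 2"
  shows "seifert_loops w = map (\<lambda>a. (\<kappa> a, Suc (\<kappa> a))) [0..<p + q + r]"
proof -
  let ?N = "p + q + r + 3"
  \<comment> \<open>The excluded positions, counted from 0, are the last ones of the three
    blocks.\<close>
  let ?c = "\<lambda>k. k \<noteq> p \<and> k \<noteq> p + q + 1 \<and> k \<noteq> p + q + r + 2"
  have len: "length w = ?N" by (simp add: w_def)
  have nth: "\<bar>w ! k\<bar> = (if k \<le> p then 1 else if k \<le> p + q + 1 then 2 else 3)" if "k < ?N" for k
    using that unfolding w_def by (auto simp: nth_append nth_Cons' simp del: replicate.simps)
  have pred: "(k < l \<and> \<bar>w ! k\<bar> = \<bar>w ! l\<bar> \<and> (\<forall>m. k < m \<and> m < l \<longrightarrow> \<bar>w ! m\<bar> \<noteq> \<bar>w ! k\<bar>)) \<longleftrightarrow>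
      l = Suc k \<and> ?c k" if "k < ?N" "l < ?N" for k l
  proof
    assume *: "k < l \<and> \<bar>w ! k\<bar> = \<bar>w ! l\<bar> \<and> (\<forall>m. k < m \<and> m < l \<longrightarrow> \<bar>w ! m\<bar> \<noteq> \<bar>w ! k\<bar>)"
    \<comment> \<open>Absolute values of letters never decrease along \<open>w\<close>, so once
      left, the value at \<open>k\<close> cannot recur at \<open>l\<close>.\<close>
    have "l = Suc k"
    proof (rule ccontr)
      assume "l \<noteq> Suc k"
      then have "Suc k < l" "\<bar>w ! Suc k\<bar> \<noteq> \<bar>w ! k\<bar>" using * by auto
      with * show False using that by (auto simp: nth split: if_splits)
    qed
    with * show "l = Suc k \<and> ?c k" using that by (auto simp: nth split: if_splits)
  next
    assume "l = Suc k \<and> ?c k"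
    then show "k < l \<and> \<bar>w ! k\<bar> = \<bar>w ! l\<bar> \<and> (\<forall>m. k < m \<and> m < l \<longrightarrow> \<bar>w ! m\<bar> \<noteq> \<bar>w ! k\<bar>)"
      using that by (auto simp: nth)
  qed
  have "seifert_loops w =
      concat (map (\<lambda>k. map (Pair k) (filter (\<lambda>l. l = Suc k \<and> ?c k) [0..<?N])) [0..<?N])"
    unfolding seifert_loops_def len filter_product prod.case
  proof (rule arg_cong[where f = concat], rule map_cong[OF refl])
    fix k assume k: "k \<in> set [0..<?N]"
    have "filter (\<lambda>l. k < l \<and> \<bar>w ! k\<bar> = \<bar>w ! l\<bar> \<and>
          (\<forall>m. k < m \<and> m < l \<longrightarrow> \<bar>w ! m\<bar> \<noteq> \<bar>w ! k\<bar>)) [0..<?N] =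
        filter (\<lambda>l. l = Suc k \<and> ?c k) [0..<?N]"
      using k pred by (intro filter_cong refl) simp
    then show "map (Pair k) (filter (\<lambda>l. k < l \<and> \<bar>w ! k\<bar> = \<bar>w ! l\<bar> \<and>
          (\<forall>m. k < m \<and> m < l \<longrightarrow> \<bar>w ! m\<bar> \<noteq> \<bar>w ! k\<bar>)) [0..<?N]) =
        map (Pair k) (filter (\<lambda>l. l = Suc k \<and> ?c k) [0..<?N])"
      by (rule arg_cong)
  qed
  also have "\<dots> = concat (map (\<lambda>k. if ?c k then [(k, Suc k)] else []) [0..<?N])"
  proof (intro arg_cong[where f = concat] map_cong refl)
    fix k assume k: "k \<in> set [0..<?N]"
    show "map (Pair k) (filter (\<lambda>l. l = Suc k \<and> ?c k) [0..<?N]) = (if ?c k then [(k, Suc k)] else [])"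
    proof (cases "?c k")
      case True
      then have "Suc k < ?N" using k by auto
      then show ?thesis using True filter_eq_upt[of "Suc k" ?N] by (simp del: upt_Suc)
    next
      case False
      then have "filter (\<lambda>l. l = Suc k \<and> ?c k) [0..<?N] = []" by (simp only: filter_False) simp
      with False show ?thesis by simp
    qed
  qed
  also have "\<dots> = map (\<lambda>k. (k, Suc k)) (filter ?c [0..<?N])"
    by (rule concat_map_if_singleton)
  also have "filter ?c [0..<?N] = map \<kappa> [0..<p + q + r]"
  \<comment> \<open>Both lists are strictly increasing, so it suffices to compare their
    sets.\<close>
  proof (rule sorted_distinct_set_unique)
    have mono: "\<kappa> a < \<kappa> b" if "a < b" for a b
      using that by (auto simp: \<kappa>_def)
    have "sorted_wrt (<) (map \<kappa> [0..<p + q + r])"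
      unfolding sorted_wrt_map using mono
      by (intro sorted_wrt_mono_rel[OF _ sorted_wrt_upt]) auto
    then show "sorted (map \<kappa> [0..<p + q + r])" "distinct (map \<kappa> [0..<p + q + r])"
      by (auto simp: strict_sorted_iff)
    show "sorted (filter ?c [0..<?N])"
      using sorted_filter[of "\<lambda>x. x" "[0..<?N]" ?c] by simp
    show "distinct (filter ?c [0..<?N])" by simp
    show "set (filter ?c [0..<?N]) = set (map \<kappa> [0..<p + q + r])"
    proof (intro equalityI subsetI)
      fix k assume "k \<in> set (filter ?c [0..<?N])"
      then have k: "k < ?N" "?c k" by auto
      consider "k < p" | "p < k" "k < p + q + 1" | "p + q + 1 < k" using k by linarith
      then have "\<exists>a<p + q + r. k = \<kappa> a"
      proof cases
        case 1
        then show ?thesis by (intro exI[of _ k]) (auto simp: \<kappa>_def)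
      next
        case 2
        then show ?thesis by (intro exI[of _ "k - 1"]) (auto simp: \<kappa>_def)
      next
        case 3
        then show ?thesis using k by (intro exI[of _ "k - 2"]) (auto simp: \<kappa>_def)
      qed
      then show "k \<in> set (map \<kappa> [0..<p + q + r])" by auto
    next
      fix k assume "k \<in> set (map \<kappa> [0..<p + q + r])"
      then obtain a where "a < p + q + r" "k = \<kappa> a" by auto
      then have "k < ?N \<and> ?c k" by (auto simp: \<kappa>_def)
      then show "k \<in> set (filter ?c [0..<?N])" by simp
    qed
  qed
  finally show ?thesis by (simp add: o_def)
qed

text \<open>Successors as exponents give the blocks exactly \<open>p\<close>, \<open>q\<close> and
  \<open>r\<close> loops. Loops of different blocks are unlinked, so the symmetrized matrix is a
  direct sum of signed Cartan matrices.\<close>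

lemma link_signature_three_blocks:
  "link_signature (n, replicate (Suc p) 1 @ replicate (Suc q) (- 2) @ replicate (Suc r) 3) =
     int q - int p - int r"
proof -
  define w :: "int list" where "w = replicate (Suc p) 1 @ replicate (Suc q) (- 2) @ replicate (Suc r) 3"
  define \<kappa> where "\<kappa> = (\<lambda>a. if a < p then a else if a < p + q then a + 1 else a + 2)"
  define g :: "nat \<Rightarrow> int" where "g a = (if a < p then 1 else if a < p + q then - 2 else 3)" for a
  have loops: "seifert_loops w = map (\<lambda>a. (\<kappa> a, Suc (\<kappa> a))) [0..<p + q + r]"
    unfolding w_def \<kappa>_def by (rule seifert_loops_three_blocks)
  have nth: "w ! k = (if k \<le> p then 1 else if k \<le> p + q + 1 then - 2 else 3)"
    if "k < p + q + r + 3" for k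
    using that unfolding w_def by (auto simp: nth_append nth_Cons' simp del: replicate.simps)
  have w: "w ! \<kappa> a = g a" "w ! Suc (\<kappa> a) = g a" if "a < p + q + r" for a
    using that by (auto simp: nth \<kappa>_def g_def)
  have \<kappa>_eq: "\<kappa> a = \<kappa> b \<longleftrightarrow> a = b" for a b
    by (auto simp: \<kappa>_def)
  \<comment> \<open>Successive loops share a band only within a block; between blocks
    \<open>\<kappa>\<close> jumps by more than 1.\<close>
  have \<kappa>_Suc: "Suc (\<kappa> a) = \<kappa> b \<longleftrightarrow> Suc a = b" if "g a = g b" for a b
    using that by (auto simp: \<kappa>_def g_def split: if_splits)
  have g_abs: "\<bar>g a\<bar> = \<bar>g b\<bar> \<longleftrightarrow> g a = g b" for a b
    by (auto simp: g_def)
  have sgn_g: "sgn (g a) = (if g a > 0 then 1 else - 1)" for a by (simp add: g_def)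
  have linking: "seifert_linking w (\<kappa> a, Suc (\<kappa> a)) (\<kappa> b, Suc (\<kappa> b)) =
      (if a = b then - sgn (g a)
       else if g a = g b \<and> b = Suc a then (if g a > 0 then 1 else 0)
       else if g a = g b \<and> a = Suc b then (if g a > 0 then 0 else - 1)
       else 0)"
    if "a < p + q + r" "b < p + q + r" for a b
  proof -
    consider "a = b" | "a \<noteq> b" "g a = g b" | "a \<noteq> b" "g a \<noteq> g b" by blast
    then show ?thesis
    proof cases
      case 1
      then show ?thesis by (simp add: seifert_linking_def w that sgn_g)
    next
      case 2
      then show ?thesis
        using \<kappa>_Suc[of a b] \<kappa>_Suc[of b a]
        by (simp add: seifert_linking_def w that \<kappa>_eq eq_commute)
    next
      case 3
      \<comment> \<open>A loop occupies adjacent positions, so no end of another loop lies strictly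
        between them and interleaving is impossible.\<close>
      then show ?thesis
        by (simp add: seifert_linking_def w that \<kappa>_eq g_abs)
    qed
  qed
  let ?M = "seifert_matrix w"
  let ?A = "cartan_mat (- 1) p" and ?B = "cartan_mat 1 q" and ?C = "cartan_mat (- 1) r"
  let ?BC = "four_block_mat ?B (0\<^sub>m q r) (0\<^sub>m r q) ?C"
  have dim: "?M \<in> carrier_mat (p + q + r) (p + q + r)"
    by (simp add: seifert_matrix_def Let_def loops)
  have "map_mat real_of_int (?M + transpose_mat ?M) =
      four_block_mat ?A (0\<^sub>m p (q + r)) (0\<^sub>m (q + r) p) ?BC"
  proof (rule eq_matI)
    fix a b
    assume "a < dim_row (four_block_mat ?A (0\<^sub>m p (q + r)) (0\<^sub>m (q + r) p) ?BC)"
      and "b < dim_col (four_block_mat ?A (0\<^sub>m p (q + r)) (0\<^sub>m (q + r) p) ?BC)"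
    then have ab: "a < p + q + r" "b < p + q + r" by (auto simp: cartan_mat_def)
    have M: "?M $$ (a, b) = seifert_linking w (\<kappa> a, Suc (\<kappa> a)) (\<kappa> b, Suc (\<kappa> b))"
      if "a < p + q + r" "b < p + q + r" for a b
      using that by (simp add: seifert_matrix_def Let_def loops)
    have "(?M + transpose_mat ?M) $$ (a, b) = ?M $$ (a, b) + ?M $$ (b, a)"
      using ab dim by simp
    \<comment> \<open>For neighbouring loops the two entries are 1 and 0, or 0 and -1; either sum is
      the sign of the letter.\<close>
    also have "\<dots> =
        (if a = b then - 2 * sgn (g a)
         else if g a = g b \<and> (a = Suc b \<or> b = Suc a) then sgn (g a) else 0)"
      by (auto simp: M ab linking sgn_g)
    finally have "map_mat real_of_int (?M + transpose_mat ?M) $$ (a, b) = real_of_int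
        (if a = b then - 2 * sgn (g a)
         else if g a = g b \<and> (a = Suc b \<or> b = Suc a) then sgn (g a) else 0)"
      using ab dim by simp
    also have "\<dots> = four_block_mat ?A (0\<^sub>m p (q + r)) (0\<^sub>m (q + r) p) ?BC $$ (a, b)"
    proof -
      have blocks: "c < p \<or> (\<exists>c'<q. c = p + c') \<or> (\<exists>c'<r. c = p + (q + c'))"
        if "c < p + q + r" for c
        using that by presburger
      show ?thesis
        using blocks[OF ab(1)] blocks[OF ab(2)]
        by (elim disjE exE conjE) (simp_all add: cartan_mat_def g_def)
    qed
    finally show "map_mat real_of_int (?M + transpose_mat ?M) $$ (a, b) =
        four_block_mat ?A (0\<^sub>m p (q + r)) (0\<^sub>m (q + r) p) ?BC $$ (a, b)" .
  qed (use dim in \<open>auto simp: cartan_mat_def\<close>)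
  moreover have "?BC \<in> carrier_mat (q + r) (q + r)" by auto
  ultimately have "link_signature (n, w) = matrix_signature ?A + (matrix_signature ?B + matrix_signature ?C)"
    by (simp add: link_signature_def Let_def matrix_signature_block_diag)
  then show ?thesis
    by (simp add: matrix_signature_cartan_mat w_def)
qed

theorem theorem4p7:
  fixes p q r :: nat
    and L :: closed_braid
    and F :: laurent
    and \<Delta> :: "closed_braid \<Rightarrow> laurent"
  assumes "p > 0" and "q > 0" and "r > 0"
    and "L = (4, replicate p 1 @ replicate q (- 2) @ replicate r 3)"
    and "alexander_polynomial \<Delta>"
    and "F = q_bracket p * q_bracket q * q_bracket r"
  shows "(\<exists>e k. e \<in> {1, - 1} \<and> \<Delta> L = Poly_Mapping.single k e * at_minus_t F) \<and>
    trapezoidal F \<and>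
    (\<exists>l. stable_part_length F l \<and> int l \<le> \<bar>link_signature L\<bar>)"
proof (intro conjI)
  show "\<exists>e k. e \<in> {1, - 1} \<and> \<Delta> L = Poly_Mapping.single k e * at_minus_t F"
    unfolding \<open>L = _\<close> \<open>F = _\<close> using assms by (intro alexander_three_blocks)
  \<comment> \<open>Blocks of \<open>p\<close>, \<open>q\<close>, \<open>r\<close> letters carry one
    loop fewer each: \<open>(q - 1) - (p - 1) - (r - 1)\<close>.\<close>
  have "link_signature L = int q + 1 - int p - int r"
    using link_signature_three_blocks[of 4 "p - 1" "q - 1" "r - 1"] assms by simp
  then show *: "\<exists>l. stable_part_length F l \<and> int l \<le> \<bar>link_signature L\<bar>"
    using stable_part_length_le[OF assms(1-3)] assms(6) by simp
  then show "trapezoidal F"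
    using stable_part_length_imp_trapezoidal by blast
qed

end
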